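(* Let $\tau$ be the unique positive solution of $\coth\frac\tau2=\frac\tau2$ and let $F(t)=1-\left(\cosh t-\frac12t\sinh t\right)$. The curve $$\{(x,y)\in[0,\tau]\times[0,\pi] : 1-\cos y=F(x)\}$$ is the graph of a convex function $y=y(x)$ of $x\in[0,\tau]$, for which $$\lim_{x\to\tau^-}y'(x)=+\infty$$ and, for some $C\ge0$, $$\frac{1}{2\sqrt3}x^2\le y(x)\le\frac{1}{2\sqrt3}x^2+Cx^4,\quad\forall x\in[0,\tau].$$ *)

theory Defs
  imports "HOL-Analysis.Analysis"
begin

definition coth :: "real \<Rightarrow> real" where
  "coth x = cosh x / sinh x"

definition tau :: real where
  "tau = (THE t. t > 0 \<and> coth (t / 2) = t / 2)"

definition F :: "real \<Rightarrow> real" where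
  "F t = 1 - (cosh t - 1 / 2 * t * sinh t)"

definition curve :: "(real \<times> real) set" where
  "curve = {(x, y) \<in> {0..tau} \<times> {0..pi}. 1 - cos y = F x}"

end

(* With F' = (t cosh t - sinh t) / 2 and F'' = t sinh t / 2, the curve is the graph of
   y = 2 arcsin (sqrt (F / 2)), whose derivative is (F' / sqrt F) * (1 / sqrt (2 - F)).
   Since (2 F F'' - F'^2)' = 2 F F''' >= 0, the first factor, of square F'^2 / F, is increasing; the second one is
   increasing because F is, and it blows up at tau because F tau = 2.
   Integrating t^2 / 2 <= F'' <= t^2 / 2 + M t^4 / 6 twice bounds F by t^4 / 24 up to O(t^6), and
   u <= arcsin u <= u + O(u^2) turns this into the two-sided bound on y. *)
theory Submission
  imports Defs
begin

section \<open>Preliminaries: convexity up to the endpoints, integrated inequalities, bounds on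
  arcsin\<close>

lemma convex_on_Icc_if_convex_on_Ioo:
  fixes f :: "real \<Rightarrow> real"
  assumes "a < b" and cvx: "convex_on {a<..<b} f" and cont: "continuous_on {a..b} f"
  shows "convex_on {a..b} f"
proof (rule convex_onI)
  fix t x y :: real
  assume t: "0 < t" "t < 1" and x: "x \<in> {a..b}" and y: "y \<in> {a..b}"
  \<comment> \<open>\<open>s e\<close> shrinks the closed interval towards its midpoint. For 0 < e <
    1 its image lies in the open interval, and being affine it preserves convex combinations. The
    inequality thus holds for the shrunken points, and continuity carries it to the limit e
    \<rightarrow> 0.\<close>
  define s where "s e z = (1 - e) * z + e * ((a + b) / 2)" for e z :: real
  define w where "w = (1 - t) * x + t * y"
  have w: "w \<in> {a..b}"
    using convexD_alt[OF convex_real_interval(5), of x a b y t] t x y by (simp add: w_def)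
  have s_in: "s e z \<in> {a<..<b}" if "z \<in> {a..b}" "0 < e" "e < 1" for e z
  proof -
    have "(1 - e) * a \<le> (1 - e) * z" "(1 - e) * z \<le> (1 - e) * b"
      using that by (auto intro!: mult_left_mono)
    moreover have "e * a < e * ((a + b) / 2)" "e * ((a + b) / 2) < e * b"
      using that \<open>a < b\<close> by (auto intro!: mult_strict_left_mono)
    moreover have "(1 - e) * a + e * a = a" "(1 - e) * b + e * b = b"
      by (simp_all add: algebra_simps)
    ultimately show ?thesis
      unfolding s_def greaterThanLessThan_iff by linarith
  qed
  have ev: "\<forall>\<^sub>F e in at_right 0. e \<in> {0<..<1::real}"
    by (rule eventually_at_right_real) simp
  have lim: "((\<lambda>e. f (s e z)) \<longlongrightarrow> f z) (at_right 0)" if z: "z \<in> {a..b}" for z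
  proof (rule continuous_on_tendsto_compose[OF cont _ z])
    have "((\<lambda>e. s e z) \<longlongrightarrow> (1 - 0) * z + 0 * ((a + b) / 2)) (at_right 0)"
      unfolding s_def by (intro tendsto_intros)
    then show "((\<lambda>e. s e z) \<longlongrightarrow> z) (at_right 0)" by simp
    show "\<forall>\<^sub>F e in at_right 0. s e z \<in> {a..b}"
      using ev by eventually_elim (use s_in[OF z] in force)
  qed
  have "f w \<le> (1 - t) * f x + t * f y"
  proof (rule tendsto_le[OF _ _ lim[OF w]])
    show "((\<lambda>e. (1 - t) * f (s e x) + t * f (s e y)) \<longlongrightarrow> (1 - t) * f x + t * f y) (at_right 0)"
      by (intro tendsto_intros lim x y)
    show "\<forall>\<^sub>F e in at_right 0. f (s e w) \<le> (1 - t) * f (s e x) + t * f (s e y)"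
      using ev
    proof eventually_elim
      case (elim e)
      have "s e w = (1 - t) *\<^sub>R s e x + t *\<^sub>R s e y"
        by (simp add: s_def w_def algebra_simps) (simp add: field_simps)
      then show ?case
        using convex_onD[OF cvx, of t "s e x" "s e y"] t s_in x y elim by auto
    qed
  qed simp
  then show "f ((1 - t) *\<^sub>R x + t *\<^sub>R y) \<le> (1 - t) * f x + t * f y"
    by (simp add: w_def)
qed simp

text \<open>The difference \<open>g - f\<close> has nonnegative derivative, so it does not decrease.
  Inequalities are integrated with this rule: b = x suits those valid on the whole half line, a
  fixed b those whose constants depend on the range.\<close>

lemma le_by_DERIV_le:
  fixes f g :: "real \<Rightarrow> real"
  assumes "a \<le> x" "x \<le> b" "f a \<le> g a"
    and "\<And>t. (f has_real_derivative f' t) (at t)" "\<And>t. (g has_real_derivative g' t) (at t)"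
    and "\<And>t. a \<le> t \<Longrightarrow> t \<le> b \<Longrightarrow> f' t \<le> g' t"
  shows "f x \<le> g x"
proof -
  have "g a - f a \<le> g x - f x"
  proof (rule DERIV_nonneg_imp_nondecreasing[OF \<open>a \<le> x\<close>])
    fix t assume "a \<le> t" "t \<le> x"
    then show "\<exists>y. ((\<lambda>t. g t - f t) has_real_derivative y) (at t) \<and> 0 \<le> y"
      using assms by (intro exI[of _ "g' t - f' t"]) (auto intro!: DERIV_diff)
  qed
  with \<open>f a \<le> g a\<close> show ?thesis by simp
qed

lemma sin_ge_diff_square:
  fixes x :: real
  assumes "0 \<le> x"
  shows "x - x\<^sup>2 / 2 \<le> sin x"
proof (rule le_by_DERIV_le[OF assms order_refl])
  show "((\<lambda>x. x - x\<^sup>2 / 2) has_real_derivative 1 - t) (at t)" for t :: real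
    by (auto intro!: derivative_eq_intros)
  \<comment> \<open>The same rule once more, starting from -1 \<le> -sin.\<close>
  show "1 - t \<le> cos t" if "0 \<le> t" for t :: real
    by (rule le_by_DERIV_le[OF that order_refl, where f' = "\<lambda>_. - 1" and g' = "\<lambda>x. - sin x"])
      (auto intro!: derivative_eq_intros)
qed (auto intro!: derivative_eq_intros)

text \<open>Only the order of the error matters. For x = arcsin u, x \<le> pi / 2 < 8/5 gives 1 -
  x/2 \<ge> 1/5, so x/5 \<le> x - x^2/2 \<le> sin x = u. Hence x \<le> 5u, and x \<le> u + x^2/2
  \<le> u + 25 u^2/2, with 25/2 rounded up to 13.\<close>

lemma arcsin_le_quadratic:
  assumes "0 \<le> u" "u \<le> 1"
  shows "arcsin u \<le> u + 13 * u\<^sup>2"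
proof -
  define x where "x = arcsin u"
  have u: "sin x = u" using assms by (simp add: x_def)
  have x: "0 \<le> x" "x \<le> pi / 2"
    using assms arcsin_le_arcsin[of 0 u] arcsin_ubound[of u] by (auto simp: x_def)
  have "x \<le> 8 / 5" using x pi_less_4 pi_approx by simp
  then have "x * (1 / 5) \<le> x * (1 - x / 2)"
    using x by (intro mult_left_mono) auto
  also have "\<dots> \<le> u"
    using sin_ge_diff_square[OF x(1)] u by (simp add: algebra_simps power2_eq_square)
  finally have "x\<^sup>2 \<le> (5 * u)\<^sup>2"
    using x by (intro power_mono) auto
  then show ?thesis
    using sin_ge_diff_square[OF x(1)] u by (simp add: x_def power_mult_distrib)
      (use zero_le_power2[of u] in linarith)
qed

lemma arcsin_ge_self:
  assumes "0 \<le> u" "u \<le> 1"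
  shows "u \<le> arcsin u"
  using assms sin_x_le_x[of "arcsin u"] arcsin_le_arcsin[of 0 u] by simp

section \<open>Derivatives, growth and monotonicity of \<open>F\<close>\<close>

definition F' :: "real \<Rightarrow> real" where
  "F' t = (t * cosh t - sinh t) / 2"

lemma F_DERIV [derivative_intros]: "(F has_real_derivative F' t) (at t)"
  unfolding F_def[abs_def] F'_def
  by (auto intro!: derivative_eq_intros simp: field_simps)

lemma F'_DERIV [derivative_intros]: "(F' has_real_derivative t * sinh t / 2) (at t)"
  unfolding F'_def[abs_def]
  by (auto intro!: derivative_eq_intros simp: field_simps)

lemma isCont_F: "isCont F t" and isCont_F': "isCont F' t"
  using F_DERIV F'_DERIV DERIV_isCont by blast+

lemma F_0 [simp]: "F 0 = 0" and F'_0 [simp]: "F' 0 = 0"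
  by (simp_all add: F_def F'_def)

lemma sinh_ge_self:
  fixes t :: real
  assumes "0 \<le> t"
  shows "t \<le> sinh t"
  by (rule le_by_DERIV_le[OF assms order_refl, where f' = "\<lambda>_. 1" and g' = cosh])
    (auto intro!: derivative_eq_intros cosh_real_ge_1)

lemma F'_lower:
  assumes "0 \<le> t"
  shows "t ^ 3 / 6 \<le> F' t"
proof (rule le_by_DERIV_le[OF assms order_refl])
  show "x\<^sup>2 / 2 \<le> x * sinh x / 2" if "0 \<le> x" for x :: real
    using that mult_left_mono[OF sinh_ge_self[OF that] that] by (simp add: power2_eq_square)
qed (auto intro!: derivative_eq_intros)

lemma F_lower:
  assumes "0 \<le> t"
  shows "t ^ 4 / 24 \<le> F t"
  by (rule le_by_DERIV_le[OF assms order_refl, where f' = "\<lambda>t. t ^ 3 / 6" and g' = F'])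
    (use F'_lower in \<open>auto intro!: derivative_eq_intros\<close>)

lemma F_nonneg: "0 \<le> t \<Longrightarrow> 0 \<le> F t"
  by (rule order_trans[OF _ F_lower]) auto

lemma F_pos: "0 < t \<Longrightarrow> 0 < F t"
  by (rule less_le_trans[OF _ F_lower]) auto

lemma F'_pos: "0 < t \<Longrightarrow> 0 < F' t"
  by (rule less_le_trans[OF _ F'_lower]) auto

lemma F_less:
  assumes "0 \<le> s" "s < t"
  shows "F s < F t"
\<comment> \<open>\<open>F'\<close> vanishes at 0, so s = 0 calls for the criterion that asks for a
  positive derivative only inside the interval.\<close>
proof (rule DERIV_pos_imp_increasing_open[OF \<open>s < t\<close>])
  show "\<exists>y. DERIV F x :> y \<and> 0 < y" if "s < x" for x
    using F_DERIV F'_pos that assms(1) by (meson le_less_trans)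
qed (auto intro!: continuous_at_imp_continuous_on isCont_F)

lemma F_le: "0 \<le> s \<Longrightarrow> s \<le> t \<Longrightarrow> F s \<le> F t"
  using F_less[of s t] by (cases "s = t") auto

text \<open>On [0, b] the factor cosh is at most the constant \<open>cosh b\<close>. This turns sinh
  x \<le> x cosh x into a linear bound, which is integrated to a bound on cosh and then on
  sinh.\<close>

lemma sinh_upper:
  fixes t :: real
  assumes "0 \<le> t" "t \<le> b"
  shows "sinh t \<le> t + cosh b * t ^ 3 / 3"
proof -
  have cosh_le: "cosh x \<le> cosh b" if "0 \<le> x" "x \<le> b" for x :: real
    using that by (simp add: cosh_real_nonneg_le_iff)
  have cosh_upper: "cosh t \<le> 1 + cosh b * t\<^sup>2" if t: "0 \<le> t" "t \<le> b" for t
  proof (rule le_by_DERIV_le[OF t])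
    show "sinh x \<le> cosh b * x * 2" if x: "0 \<le> x" "x \<le> b" for x :: real
    proof -
      have "sinh x \<le> x * cosh x"
        \<comment> \<open>Positivity of \<open>F' x\<close> is precisely sinh x < x cosh x.\<close>
        using F'_pos[of x] x by (cases "x = 0") (auto simp: F'_def)
      also have "\<dots> \<le> x * cosh b"
        using x cosh_le by (intro mult_left_mono) auto
      also have "\<dots> \<le> cosh b * x * 2"
        using x by simp
      finally show ?thesis .
    qed
  qed (auto intro!: derivative_eq_intros)
  show ?thesis
    by (rule le_by_DERIV_le[OF assms, where f' = cosh and g' = "\<lambda>t. 1 + cosh b * t\<^sup>2"])
      (auto intro!: derivative_eq_intros cosh_upper)
qed

lemma F_upper:
  assumes "0 \<le> t" "t \<le> b"
  shows "F t \<le> t ^ 4 / 24 * (1 + cosh b * t\<^sup>2)"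
proof -
  have F'_upper: "F' t \<le> t ^ 3 / 6 + cosh b * t ^ 5 / 30" if t: "0 \<le> t" "t \<le> b" for t
  proof (rule le_by_DERIV_le[OF t])
    show "x * sinh x / 2 \<le> x\<^sup>2 / 2 + cosh b * x ^ 4 / 6" if x: "0 \<le> x" "x \<le> b" for x
      using mult_left_mono[OF sinh_upper[OF x] x(1)]
      by (simp add: field_simps power2_eq_square power3_eq_cube power4_eq_xxxx)
  qed (auto intro!: derivative_eq_intros)
  have "F t \<le> t ^ 4 / 24 + cosh b * t ^ 6 / 180"
    by (rule le_by_DERIV_le[OF assms, where f' = F' and g' = "\<lambda>t. t ^ 3 / 6 + cosh b * t ^ 5 / 30"])
      (auto intro!: derivative_eq_intros F'_upper)
  \<comment> \<open>Weakening 180 to 24 lets t^4/24 be factored out, which is convenient for the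
    square root taken later.\<close>
  also have "\<dots> \<le> t ^ 4 / 24 + cosh b * t ^ 6 / 24"
    by (simp add: field_simps)
  also have "\<dots> = t ^ 4 / 24 * (1 + cosh b * t\<^sup>2)"
    by (simp add: field_simps flip: power_add)
  finally show ?thesis .
qed

text \<open>As \<open>t * sinh t\<close> is 2F'', this is the sign of 2FF'' - F'^2. Both sides
  vanish at 0, and their derivatives differ by \<open>F t * (sinh t + t * cosh t)\<close>, which is
  2FF''' and nonnegative.\<close>

lemma F'_square_le:
  assumes "0 \<le> t"
  shows "(F' t)\<^sup>2 \<le> F t * (t * sinh t)"
proof (rule le_by_DERIV_le[OF assms order_refl])
  show "((\<lambda>t. (F' t)\<^sup>2) has_real_derivative F' t * (t * sinh t)) (at t)" for t
    by (auto intro!: derivative_eq_intros)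
  show "((\<lambda>t. F t * (t * sinh t)) has_real_derivative
      F' t * (t * sinh t) + F t * (sinh t + t * cosh t)) (at t)" for t
    by (auto intro!: derivative_eq_intros simp: algebra_simps)
  show "F' t * (t * sinh t) \<le> F' t * (t * sinh t) + F t * (sinh t + t * cosh t)"
    if "0 \<le> t" for t
    using that F_nonneg by simp
qed simp

text \<open>Passing to the square avoids differentiating a root: F'^2/F has derivative F'(2FF'' -
  F'^2)/F^2 \<ge> 0, and \<open>F'\<close> > 0 allows the roots to be taken back.\<close>

lemma F'_div_sqrt_F_mono:
  assumes "0 < s" "s \<le> t"
  shows "F' s / sqrt (F s) \<le> F' t / sqrt (F t)"
proof -
  have "(F' s)\<^sup>2 / F s \<le> (F' t)\<^sup>2 / F t"
  proof (rule DERIV_nonneg_imp_nondecreasing[OF \<open>s \<le> t\<close>])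
    fix x assume "s \<le> x"
    with assms have x: "0 < x" by simp
    have "((\<lambda>x. (F' x)\<^sup>2 / F x) has_real_derivative
        F' x * (F x * (x * sinh x) - (F' x)\<^sup>2) / (F x)\<^sup>2) (at x)"
      using F_pos[OF x]
      by (auto intro!: derivative_eq_intros simp: field_simps power2_eq_square)
    moreover have "0 \<le> F' x * (F x * (x * sinh x) - (F' x)\<^sup>2) / (F x)\<^sup>2"
      using F'_pos[OF x] F'_square_le[of x] x by simp
    ultimately show "\<exists>y. ((\<lambda>x. (F' x)\<^sup>2 / F x) has_real_derivative y) (at x) \<and> 0 \<le> y"
      by blast
  qed
  then have "sqrt ((F' s)\<^sup>2 / F s) \<le> sqrt ((F' t)\<^sup>2 / F t)" by simp
  then show ?thesis
    using assms F'_pos[of s] F'_pos[of t] by (simp add: real_sqrt_divide)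
qed

section \<open>The endpoint \<open>tau\<close> as the point where \<open>F\<close> reaches 2\<close>

lemma coth_half_eq_iff:
  assumes "0 < t"
  shows "coth (t / 2) = t / 2 \<longleftrightarrow> F t = 2"
proof -
  define c s where "c = cosh (t / 2)" and "s = sinh (t / 2)"
  have s: "0 < s" and c: "0 < c" using assms by (auto simp: s_def c_def)
  have cosh: "cosh t = 2 * c\<^sup>2 - 1" and sinh: "sinh t = 2 * s * c"
    using cosh_double_cosh[of "t / 2"] sinh_double[of "t / 2"] by (simp_all add: s_def c_def)
  \<comment> \<open>The half-argument formulas factor F - 2. Since c > 0, only the second factor can
    vanish, and dividing by s > 0 turns its equation into the one for \<open>coth\<close>.\<close>
  have "F t - 2 = 2 * c * (t / 2 * s - c)"
    by (simp add: F_def cosh sinh algebra_simps power2_eq_square)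
  then have "F t = 2 \<longleftrightarrow> t / 2 * s = c" using c by auto
  then show ?thesis
    using s by (auto simp: coth_def field_simps simp flip: s_def c_def)
qed

lemma ex1_coth_half: "\<exists>!t::real. t > 0 \<and> coth (t / 2) = t / 2"
proof -
  \<comment> \<open>The point 3 is far enough, since F 3 \<ge> 81/24 > 2.\<close>
  have "\<exists>t. 0 \<le> t \<and> t \<le> 3 \<and> F t = 2"
    by (rule IVT) (use F_lower[of 3] isCont_F in auto)
  then obtain t where t: "0 \<le> t" "F t = 2" by blast
  then have "0 < t" by (cases "t = 0") auto
  show ?thesis
  proof (rule ex1I[of _ t])
    show "t > 0 \<and> coth (t / 2) = t / 2"
      using t \<open>0 < t\<close> coth_half_eq_iff by blast
    fix u :: real assume u: "u > 0 \<and> coth (u / 2) = u / 2"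
    then have "F u = 2" using coth_half_eq_iff by blast
    then show "u = t" using t u F_less[of u t] F_less[of t u] by force
  qed
qed

text \<open>Unique existence gives the definite description \<open>tau\<close> its meaning. The
  value 2 is the maximum of 1 - cos y, so the curve reaches y = pi exactly at
  \<open>tau\<close>.\<close>

lemma tau_pos: "0 < tau" and F_tau: "F tau = 2"
  using theI'[OF ex1_coth_half, folded tau_def] coth_half_eq_iff by auto

lemma F_le_2: "x \<in> {0..tau} \<Longrightarrow> F x \<le> 2"
  using F_le[of x tau] F_tau by simp

lemma F_less_2: "x \<in> {0..<tau} \<Longrightarrow> F x < 2"
  using F_less[of x tau] F_tau by simp

section \<open>The graph function: parametrization of the curve, derivative, convexity\<close>

definition Y :: "real \<Rightarrow> real" where
  "Y x = 2 * arcsin (sqrt (F x / 2))"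

lemma sqrt_F_range: "x \<in> {0..tau} \<Longrightarrow> 0 \<le> sqrt (F x / 2) \<and> sqrt (F x / 2) \<le> 1"
  using F_nonneg[of x] F_le_2[of x] by simp

lemma Y_range:
  assumes "x \<in> {0..tau}"
  shows "Y x \<in> {0..pi}"
  using sqrt_F_range[OF assms] arcsin_bounded[of "sqrt (F x / 2)"]
    arcsin_le_arcsin[of 0 "sqrt (F x / 2)"] by (auto simp: Y_def simp del: real_sqrt_ge_0_iff real_sqrt_le_1_iff)

lemma cos_Y:
  assumes "x \<in> {0..tau}"
  shows "1 - cos (Y x) = F x"
proof -
  have "sin (arcsin (sqrt (F x / 2))) = sqrt (F x / 2)"
    using sqrt_F_range[OF assms] by (intro sin_arcsin) linarith+
  \<comment> \<open>\<open>Y\<close> is the solution of 1 - cos y = 2 sin^2 (y/2) = F x.\<close>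
  then have "cos (Y x) = 1 - 2 * (sqrt (F x / 2))\<^sup>2"
    unfolding Y_def cos_double_sin by simp
  then show ?thesis using F_nonneg[of x] assms by simp
qed

lemma curve_eq_graph: "curve = {(x, Y x) | x. x \<in> {0..tau}}"
proof -
  have graph: "y \<in> {0..pi} \<and> 1 - cos y = F x \<longleftrightarrow> y = Y x" if x: "x \<in> {0..tau}" for x y
  proof
    assume "y \<in> {0..pi} \<and> 1 - cos y = F x"
    then have "0 \<le> y" "y \<le> pi" "cos y = cos (Y x)"
      using cos_Y[OF x] by auto
    then show "y = Y x"
      using Y_range[OF x] by (metis atLeastAtMost_iff cos_inj_pi)
  next
    assume "y = Y x"
    then show "y \<in> {0..pi} \<and> 1 - cos y = F x"
      using cos_Y[OF x] Y_range[OF x] by blast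
  qed
  have "(x, y) \<in> curve \<longleftrightarrow> x \<in> {0..tau} \<and> y = Y x" for x y
    using graph[of x y] by (auto simp: curve_def simp del: atLeastAtMost_iff)
  then show ?thesis
    by (intro set_eqI) (simp add: split_paired_all conj_ac)
qed

text \<open>Inside the interval 0 < F < 2, which keeps the root away from 0 and the argument of
  arcsin below 1. The derivative is written as a product of two factors so that each can be shown to
  be increasing.\<close>

lemma Y_DERIV:
  assumes "x \<in> {0<..<tau}"
  shows "(Y has_real_derivative F' x / sqrt (F x) * inverse (sqrt (2 - F x))) (at x)"
proof -
  have F: "0 < F x" "F x < 2" using F_pos[of x] F_less_2[of x] assms by auto
  define r where "r = sqrt (F x / 2)"
  have r: "0 < r" "r < 1" using F by (auto simp: r_def)
  have "((\<lambda>x. sqrt (F x / 2)) has_real_derivative (F' x / 2) * (inverse r / 2)) (at x)"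
    using F by (auto intro!: derivative_eq_intros simp: r_def)
  moreover have "(arcsin has_real_derivative inverse (sqrt (1 - r\<^sup>2))) (at r)"
    using r by (intro DERIV_arcsin) auto
  ultimately have "((\<lambda>x. arcsin (sqrt (F x / 2))) has_real_derivative
      inverse (sqrt (1 - r\<^sup>2)) * ((F' x / 2) * (inverse r / 2))) (at x)"
    unfolding r_def by (rule DERIV_chain2[rotated])
  then have deriv: "(Y has_real_derivative
      2 * (inverse (sqrt (1 - r\<^sup>2)) * ((F' x / 2) * (inverse r / 2)))) (at x)"
    unfolding Y_def[abs_def] by (rule DERIV_cmult)
  \<comment> \<open>Both inverse factors carry a sqrt 2, and the resulting 2 cancels the remaining
    factor 1/2 from the chain rule.\<close>
  have "1 - r\<^sup>2 = (2 - F x) / 2" using F by (simp add: r_def field_simps)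
  then have "sqrt (1 - r\<^sup>2) = sqrt (2 - F x) / sqrt 2"
    by (simp only: real_sqrt_divide)
  moreover have "inverse r = sqrt 2 / sqrt (F x)"
    by (simp add: r_def real_sqrt_divide)
  ultimately have inverses: "inverse (sqrt (1 - r\<^sup>2)) * inverse r =
      2 * (inverse (sqrt (2 - F x)) * inverse (sqrt (F x)))"
    by (simp only: inverse_divide) (simp add: divide_inverse)
  have "2 * (inverse (sqrt (1 - r\<^sup>2)) * ((F' x / 2) * (inverse r / 2))) =
      F' x / 2 * (inverse (sqrt (1 - r\<^sup>2)) * inverse r)"
    by simp
  also have "\<dots> = F' x / 2 * (2 * (inverse (sqrt (2 - F x)) * inverse (sqrt (F x))))"
    by (simp only: inverses)
  also have "\<dots> = F' x / sqrt (F x) * inverse (sqrt (2 - F x))"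
    by (simp add: divide_inverse[of _ "sqrt (F x)"])
  finally show ?thesis
    using deriv by simp
qed

lemma continuous_on_Y: "continuous_on {0..tau} Y"
proof -
  have "continuous_on {0..tau} (\<lambda>x. sqrt (F x / 2))"
    by (intro continuous_intros continuous_at_imp_continuous_on ballI isCont_F) simp
  moreover have "\<forall>x\<in>{0..tau}. - 1 \<le> sqrt (F x / 2) \<and> sqrt (F x / 2) \<le> 1"
    using sqrt_F_range by (meson neg_le_0_iff_le order_trans zero_le_one)
  ultimately show ?thesis
    unfolding Y_def[abs_def] by (intro continuous_on_mult continuous_on_const continuous_on_arcsin)
qed

lemma convex_on_Y: "convex_on {0..tau} Y"
\<comment> \<open>The derivative formula is available only inside: at 0 its first factor is a
  quotient 0/0, and at \<open>tau\<close> the second blows up. Continuity covers the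
  endpoints.\<close>
proof (rule convex_on_Icc_if_convex_on_Ioo[OF tau_pos _ continuous_on_Y])
  show "convex_on {0<..<tau} Y"
  proof (rule convex_on_realI[OF _ Y_DERIV])
    fix s t :: real assume st: "s \<in> {0<..<tau}" "t \<in> {0<..<tau}" "s \<le> t"
    have "inverse (sqrt (2 - F s)) \<le> inverse (sqrt (2 - F t))"
      using F_le[of s t] F_less_2[of t] st by (intro le_imp_inverse_le) auto
    then show "F' s / sqrt (F s) * inverse (sqrt (2 - F s))
        \<le> F' t / sqrt (F t) * inverse (sqrt (2 - F t))"
      using F'_div_sqrt_F_mono[of s t] st F'_pos[of t] F_pos[of t] F_less_2[of s]
      by (intro mult_mono) auto
  qed auto
qed

text \<open>The first factor tends to F'(tau)/sqrt 2 > 0, while 2 - F tends to 0 through positive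
  values.\<close>

lemma deriv_Y_at_top: "filterlim (deriv Y) at_top (at_left tau)"
proof -
  have ev: "\<forall>\<^sub>F x in at_left tau. x \<in> {0<..<tau}"
    by (rule eventually_at_left_real[OF tau_pos])
  have F_lim: "(F \<longlongrightarrow> 2) (at_left tau)" and F'_lim: "(F' \<longlongrightarrow> F' tau) (at_left tau)"
    using isCont_F[of tau] isCont_F'[of tau] F_tau
    by (simp_all add: isCont_def filterlim_at_split)
  have "((\<lambda>x. sqrt (2 - F x)) \<longlongrightarrow> sqrt (2 - 2)) (at_left tau)"
    by (intro tendsto_intros F_lim)
  then have "filterlim (\<lambda>x. inverse (sqrt (2 - F x))) at_top (at_left tau)"
  proof (intro filterlim_inverse_at_top)
    show "\<forall>\<^sub>F x in at_left tau. 0 < sqrt (2 - F x)"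
      using ev by eventually_elim (use F_less_2 in auto)
  qed simp
  moreover have F'_div: "((\<lambda>x. F' x / sqrt (F x)) \<longlongrightarrow> F' tau / sqrt 2) (at_left tau)"
    by (intro tendsto_intros F_lim F'_lim) simp
  ultimately have "filterlim (\<lambda>x. F' x / sqrt (F x) * inverse (sqrt (2 - F x))) at_top (at_left tau)"
    using F'_pos[OF tau_pos] by (intro filterlim_tendsto_pos_mult_at_top[OF F'_div]) auto
  \<comment> \<open>\<open>deriv Y\<close> is known only on the open interval, which is enough for a
    limit from the left.\<close>
  moreover have deriv: "\<forall>\<^sub>F x in at_left tau. F' x / sqrt (F x) * inverse (sqrt (2 - F x)) = deriv Y x"
    using ev by eventually_elim (rule DERIV_imp_deriv[OF Y_DERIV, symmetric])
  ultimately show ?thesis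
    by (simp only: filterlim_cong[OF refl refl deriv])
qed

section \<open>The two-sided bound on the graph function\<close>

lemma two_sqrt_div_48: "2 * sqrt (a ^ 4 / 48) = 1 / (2 * sqrt 3) * a\<^sup>2"
proof -
  \<comment> \<open>Here a^4/48 is half the leading term a^4/24 of \<open>F\<close>, and 48 = (4
    sqrt 3)^2.\<close>
  have "sqrt (a ^ 4 / 48) = a\<^sup>2 / (4 * sqrt 3)"
  proof (rule real_sqrt_unique)
    show "(a\<^sup>2 / (4 * sqrt 3))\<^sup>2 = a ^ 4 / 48"
      by (simp add: power_divide power_mult_distrib flip: power_mult)
  qed simp
  then show ?thesis by (simp add: field_simps)
qed

lemma Y_lower:
  assumes "x \<in> {0..tau}"
  shows "1 / (2 * sqrt 3) * x\<^sup>2 \<le> Y x"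
proof -
  have "sqrt (x ^ 4 / 48) \<le> sqrt (F x / 2)"
    using F_lower[of x] assms by simp
  also have "\<dots> \<le> arcsin (sqrt (F x / 2))"
    using sqrt_F_range[OF assms] arcsin_ge_self by blast
  finally show ?thesis
    using two_sqrt_div_48[of x] by (simp add: Y_def)
qed

text \<open>By the quadratic arcsin bound, Y \<le> 2u + 26u^2 with u^2 = F/2. The linear part yields
  the main term and an error of order x^4; the quadratic part is itself of order x^4.\<close>

lemma Y_upper:
  assumes "x \<in> {0..tau}"
  defines "M \<equiv> cosh tau"
  shows "Y x \<le> 1 / (2 * sqrt 3) * x\<^sup>2 + (M * tau\<^sup>2 + M + 2) * x ^ 4"
proof -
  have M: "0 < M" by (simp add: M_def)
  have x: "0 \<le> x" "x \<le> tau" using assms by auto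
  define u where "u = sqrt (F x / 2)"
  have u: "0 \<le> u" "u \<le> 1" using sqrt_F_range[OF assms(1)] by (auto simp: u_def)
  have F: "F x \<le> x ^ 4 / 24 * (1 + M * x\<^sup>2)"
    unfolding M_def by (rule F_upper[OF x])
  \<comment> \<open>Completing the square: this is sqrt (1 + z) \<le> 1 + z/2 for z =
    \<open>M * x\<^sup>2\<close>.\<close>
  have "(1 + M * x\<^sup>2 / 2)\<^sup>2 = 1 + M * x\<^sup>2 + (M * x\<^sup>2 / 2)\<^sup>2"
    by (simp add: power2_sum)
  then have "1 + M * x\<^sup>2 \<le> (1 + M * x\<^sup>2 / 2)\<^sup>2"
    by simp
  then have "x ^ 4 / 48 * (1 + M * x\<^sup>2) \<le> x ^ 4 / 48 * (1 + M * x\<^sup>2 / 2)\<^sup>2"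
    by (intro mult_left_mono) auto
  with F have "u \<le> sqrt (x ^ 4 / 48 * (1 + M * x\<^sup>2 / 2)\<^sup>2)"
    unfolding u_def by (intro real_sqrt_le_mono) simp
  also have "\<dots> = sqrt (x ^ 4 / 48) * (1 + M * x\<^sup>2 / 2)"
    using M by (simp only: real_sqrt_mult real_sqrt_abs) simp
  finally have "2 * u \<le> 2 * sqrt (x ^ 4 / 48) * (1 + M * x\<^sup>2 / 2)"
    by simp
  also have "\<dots> = 1 / (2 * sqrt 3) * x\<^sup>2 + 1 / (2 * sqrt 3) * (M * x ^ 4 / 2)"
    unfolding two_sqrt_div_48 by (simp add: field_simps flip: power_add)
  also have "1 / (2 * sqrt 3) * (M * x ^ 4 / 2) \<le> 1 * (M * x ^ 4 / 2)"
  proof (rule mult_right_mono)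
    have "1 \<le> 2 * sqrt 3" using real_sqrt_ge_one[of 3] by linarith
    then show "1 / (2 * sqrt 3) \<le> 1" by simp
  qed (use M in simp)
  finally have 1: "2 * u \<le> 1 / (2 * sqrt 3) * x\<^sup>2 + M * x ^ 4 / 2" by simp
  have "u\<^sup>2 = F x / 2" using F_nonneg[of x] x by (simp add: u_def)
  also have "\<dots> \<le> x ^ 4 / 48 * (1 + M * x\<^sup>2)" using F by simp
  \<comment> \<open>Replacing x by \<open>tau\<close> in the bracket makes it constant, leaving a
    pure multiple of x^4.\<close>
  also have "\<dots> \<le> x ^ 4 / 48 * (1 + M * tau\<^sup>2)"
    using M x by (intro mult_left_mono add_left_mono power_mono) auto
  finally have "48 * u\<^sup>2 \<le> x ^ 4 * (1 + M * tau\<^sup>2)"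
    by simp
  \<comment> \<open>The coefficient 26 is twice the 13 of the arcsin bound.\<close>
  then have 2: "26 * u\<^sup>2 \<le> x ^ 4 * (1 + M * tau\<^sup>2)"
    using zero_le_power2[of u] by linarith
  have "Y x \<le> 2 * u + 26 * u\<^sup>2"
    using arcsin_le_quadratic[OF u] by (simp add: Y_def u_def)
  also have "\<dots> \<le> 1 / (2 * sqrt 3) * x\<^sup>2 + (M * x ^ 4 / 2 + x ^ 4 * (1 + M * tau\<^sup>2))"
    using 1 2 by linarith
  also have "M * x ^ 4 / 2 + x ^ 4 * (1 + M * tau\<^sup>2) \<le> (M * tau\<^sup>2 + M + 2) * x ^ 4"
    using M by (simp add: algebra_simps)
  finally show ?thesis by simp
qed

theorem proposition2p4:
  shows "(\<exists>!t::real. t > 0 \<and> coth (t / 2) = t / 2) \<and>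
    (\<exists>y :: real \<Rightarrow> real.
        curve = {(x, y x) | x. x \<in> {0..tau}} \<and>
        convex_on {0..tau} y \<and>
        (\<forall>x \<in> {0<..<tau}. y differentiable (at x)) \<and>
        filterlim (deriv y) at_top (at_left tau) \<and>
        (\<exists>C::real. C \<ge> 0 \<and>
          (\<forall>x \<in> {0..tau}.
             1 / (2 * sqrt 3) * x ^ 2 \<le> y x \<and>
             y x \<le> 1 / (2 * sqrt 3) * x ^ 2 + C * x ^ 4)))"
proof (rule conjI[OF ex1_coth_half], rule exI[of _ Y], intro conjI)
  show "\<forall>x\<in>{0<..<tau}. Y differentiable (at x)"
    using Y_DERIV real_differentiable_def by blast
  have "0 \<le> cosh tau * tau\<^sup>2 + cosh tau + 2" by simp
  then show "\<exists>C\<ge>0. \<forall>x\<in>{0..tau}. 1 / (2 * sqrt 3) * x\<^sup>2 \<le> Y x \<and>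
      Y x \<le> 1 / (2 * sqrt 3) * x\<^sup>2 + C * x ^ 4"
    using Y_lower Y_upper by blast
qed (fact curve_eq_graph convex_on_Y deriv_Y_at_top)+

end
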